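(* (Innovation null space constraint in noisy DeePC.) Consider the linear time-invariant system $x_{t+1}=Ax_t+Bu_t+w_t$, $y_t=Cx_t+Du_t+v_t$ with independent, zero-mean Gaussian process noise $w_t$ and measurement noise $v_t$, and let $E_f$ denote the future innovation Hankel matrix. For any given $(\mathbf{u}_{\mathrm{ini}},\mathbf{u},\mathbf{y}_{\mathrm{ini}})$, let $\hat{\mathbf{y}}_{\mathrm{KF}}$ be the future output sequence predicted by the steady-state Kalman filter. Then there exists a vector $g^*$ such that $$\begin{bmatrix}U_p\\ Y_p\\ U_f\end{bmatrix}g^*=\begin{bmatrix}\mathbf{u}_{\mathrm{ini}}\\ \mathbf{y}_{\mathrm{ini}}\\ \mathbf{u}\end{bmatrix},\qquad \hat{\mathbf{y}}_{\mathrm{KF}}=Y_fg^*,$$ and this $g^*$ lies in the null space of the innovation Hankel matrix: $g^*\in\mathrm{null}(E_f)$.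
   Context: System: $x_t\in\mathbb{R}^n$, $u_t\in\mathbb{R}^{n_u}$, $y_t\in\mathbb{R}^{n_y}$ are state, input and output; $A,B,C,D$ are constant real matrices of compatible sizes; $w_t,v_t$ have covariance matrices $\Sigma_w,\Sigma_v$. Steady-state Kalman filter: $\hat x_{t+1}=A\hat x_t+Bu_t+K(y_t-\hat y_t)$, $\hat y_t=C\hat x_t+Du_t$, where $K$ is the steady-state Kalman gain, computed from the discrete-time algebraic Riccati equation; under weak conditions all eigenvalues of $A-KC$ lie strictly inside the unit circle. It is viewed as a linear time-invariant predictor system with input $(u_t,y_t)$ and output $\hat y_t$: $$\hat x_{t+1}=(A-KC)\hat x_t+\begin{bmatrix}B-KD & K\end{bmatrix}\begin{bmatrix}u_t\\ y_t\end{bmatrix},\qquad \hat y_t=C\hat x_t+\begin{bmatrix}D&0\end{bmatrix}\begin{bmatrix}u_t\\ y_t\end{bmatrix}.$$ Hankel matrices: $L_p$ and $L_f$ are the past and future horizons. For a recorded sequence $\{z_k\}_{k=0}^{N+L_f-1}$, the past Hankel matrix $Z_p$ has $L_p$ block rows and $N-L_p+1$ columns, with block $(i,j)$ equal to $z_{i+j}$ ($0\le i\le L_p-1$, $0\le j\le N-L_p$); the future Hankel matrix $Z_f$ has $L_f$ block rows and $N-L_p+1$ columns, with block $(i,j)$ equal to $z_{L_p+i+j}$ ($0\le i\le L_f-1$, $0\le j\le N-L_p$). Applied to recorded input-output data $u,y$ of the system and to the output $\hat y$ of the steady-state Kalman filter driven by these data, this gives $U_p,U_f,Y_p,Y_f,\hat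 Y_p,\hat Y_f$. The innovation is $e_k=y_k-\hat y_k$, and $E_f=Y_f-\hat Y_f$ is its future Hankel matrix. The vector $g^*$ has $N-L_p+1$ entries. Standing assumptions: the input sequence $u$ is persistently exciting, so that the associated Hankel matrices have full row rank, and the rank and persistency-of-excitation assumptions of Willems' fundamental lemma are in force for the predictor system with input $(u,y)$. (A sequence is persistently exciting of order $L$ if its block Hankel matrix with $L$ block rows has full row rank. No specific order is stated; since $y$ is noisy, $Y_p$ and $Y_f$ are taken to have full row rank almost surely, so that the joint sequence $(u,y)$ is regarded as persistently exciting as soon as $u$ is.) Prediction: at time $t$, $\mathbf{u}_{\mathrm{ini}}=\mathrm{col}(u_{t-L_p},\dots,u_{t-1})$, $\mathbf{y}_{\mathrm{ini}}=\mathrm{col}(y_{t-L_p},\dots,y_{t-1})$ and $\mathbf{u}=\mathrm{col}(u_t,\dots,u_{t+L_f-1})$, where $\mathrm{col}$ denotes vertical stacking. The prediction $\hat{\mathbf{y}}_{\mathrm{KF}}=\mathrm{col}(\hat y_t,\dots,\hat y_{t+L_f-1})$ is the multi-step-ahead output of the steady-state Kalman filter, run with $\mathbf{u}_{\mathrm{ini}},\mathbf{y}_{\mathrm{ini}}$ over the past window and with future inputs $\mathbf{u}$ and zero future innovation over the future window, i.e. with the future outputs set equal to the predicted ones, $y_k=\hat y_k$ for $k=t,\dots,t+L_f-1$. *)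

theory Defs
  imports
    "HOL-Probability.Probability"
    "Jordan_Normal_Form.DL_Rank"
    "Jordan_Normal_Form.Matrix_Kernel"
    "Jordan_Normal_Form.Char_Poly"
begin

unbundle no vec_syntax
no_notation inner (infix "\<bullet>" 70)

section \<open>Random vectors\<close>

text \<open>The Borel sigma-algebra of \<open>\<real>\<^sup>n\<close>, carried over to \<open>carrier_vec n\<close> along the coordinate map.\<close>

definition vec_borel :: "nat \<Rightarrow> real Matrix.vec measure" where
  "vec_borel n =
     vimage_algebra (carrier_vec n) (\<lambda>x. \<lambda>i\<in>{..<n}. x $ i) (PiM {..<n} (\<lambda>_. borel))"

definition symmetric_psd :: "nat \<Rightarrow> real mat \<Rightarrow> bool" where
  "symmetric_psd n S \<longleftrightarrow>
     S \<in> carrier_mat n n \<and> transpose_mat S = S \<and> (\<forall>a\<in>carrier_vec n. 0 \<le> a \<bullet> (S *\<^sub>v a))"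

text \<open>Zero variance is allowed and means the point mass at 0, so that covariance matrices may be
  singular.\<close>

definition centred_gaussian :: "'w measure \<Rightarrow> real \<Rightarrow> ('w \<Rightarrow> real) \<Rightarrow> bool" where
  "centred_gaussian M s X \<longleftrightarrow>
     (if s = 0 then X \<in> borel_measurable M \<and> (AE \<omega> in M. X \<omega> = 0)
      else 0 < s \<and> distributed M lborel X (normal_density 0 (sqrt s)))"

text \<open>A random vector is Gaussian with mean 0 and covariance \<open>S\<close> iff every linear functional
  \<open>a \<bullet> X\<close> is Gaussian with mean 0 and variance \<open>a \<bullet> S a\<close>.\<close>

definition centred_gaussian_vec :: "'w measure \<Rightarrow> nat \<Rightarrow> real mat \<Rightarrow> ('w \<Rightarrow> real Matrix.vec) \<Rightarrow> bool" where
  "centred_gaussian_vec M n S X \<longleftrightarrow>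
     X \<in> measurable M (vec_borel n) \<and> symmetric_psd n S \<and>
     (\<forall>a\<in>carrier_vec n. centred_gaussian M (a \<bullet> (S *\<^sub>v a)) (\<lambda>\<omega>. a \<bullet> X \<omega>))"

section \<open>Steady-state Kalman filter\<close>

definition schur_stable :: "real mat \<Rightarrow> bool" where
  "schur_stable F \<longleftrightarrow> (\<forall>z. eigenvalue (map_mat complex_of_real F) z \<longrightarrow> cmod z < 1)"

text \<open>The Riccati equation may have several positive semidefinite solutions; the steady-state gain
  is the one of the stabilizing solution. \<open>W\<close> is the inverse of the innovation covariance.\<close>

definition steady_state_kalman_gain ::
  "nat \<Rightarrow> nat \<Rightarrow> real mat \<Rightarrow> real mat \<Rightarrow> real mat \<Rightarrow> real mat \<Rightarrow> real mat \<Rightarrow> bool" where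
  "steady_state_kalman_gain n p A C Sw Sv K \<longleftrightarrow>
     (\<exists>P W. symmetric_psd n P \<and> W \<in> carrier_mat p p \<and>
        inverts_mat (C * P * transpose_mat C + Sv) W \<and>
        P = A * P * transpose_mat A
            - A * P * transpose_mat C * W * C * P * transpose_mat A + Sw \<and>
        K = A * P * transpose_mat C * W \<and>
        schur_stable (A - K * C))"

definition kf_output :: "real mat \<Rightarrow> real mat \<Rightarrow> real Matrix.vec \<Rightarrow> real Matrix.vec \<Rightarrow> real Matrix.vec" where
  "kf_output C D xh u = C *\<^sub>v xh + D *\<^sub>v u"

definition kf_step ::
  "real mat \<Rightarrow> real mat \<Rightarrow> real mat \<Rightarrow> real mat \<Rightarrow> real mat
   \<Rightarrow> real Matrix.vec \<Rightarrow> real Matrix.vec \<Rightarrow> real Matrix.vec \<Rightarrow> real Matrix.vec" where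
  "kf_step A B C D K xh u y = A *\<^sub>v xh + B *\<^sub>v u + K *\<^sub>v (y - kf_output C D xh u)"

primrec kf_state ::
  "real mat \<Rightarrow> real mat \<Rightarrow> real mat \<Rightarrow> real mat \<Rightarrow> real mat \<Rightarrow> real Matrix.vec
   \<Rightarrow> (nat \<Rightarrow> real Matrix.vec) \<Rightarrow> (nat \<Rightarrow> real Matrix.vec) \<Rightarrow> nat \<Rightarrow> real Matrix.vec" where
  "kf_state A B C D K xh0 u y 0 = xh0"
| "kf_state A B C D K xh0 u y (Suc k) =
     kf_step A B C D K (kf_state A B C D K xh0 u y k) (u k) (y k)"

definition kf_innovation ::
  "real mat \<Rightarrow> real mat \<Rightarrow> real mat \<Rightarrow> real mat \<Rightarrow> real mat \<Rightarrow> real Matrix.vec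
   \<Rightarrow> (nat \<Rightarrow> real Matrix.vec) \<Rightarrow> (nat \<Rightarrow> real Matrix.vec) \<Rightarrow> nat \<Rightarrow> real Matrix.vec" where
  "kf_innovation A B C D K xh0 u y k =
     y k - kf_output C D (kf_state A B C D K xh0 u y k) (u k)"

section \<open>Stacked vectors and block Hankel matrices\<close>

definition col_stack :: "nat \<Rightarrow> nat \<Rightarrow> (nat \<Rightarrow> real Matrix.vec) \<Rightarrow> real Matrix.vec" where
  "col_stack m L z = Matrix.vec (L * m) (\<lambda>r. z (r div m) $ (r mod m))"

definition vec_block :: "nat \<Rightarrow> real Matrix.vec \<Rightarrow> nat \<Rightarrow> real Matrix.vec" where
  "vec_block m v i = Matrix.vec m (\<lambda>r. v $ (i * m + r))"

text \<open>\<open>L\<close> block rows, \<open>c\<close> columns, block \<open>(i, j)\<close> equal to \<open>z (s + i + j)\<close>, blocks of size \<open>m\<close>.\<close>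

definition hankel :: "nat \<Rightarrow> nat \<Rightarrow> nat \<Rightarrow> nat \<Rightarrow> (nat \<Rightarrow> real Matrix.vec) \<Rightarrow> real mat" where
  "hankel m s L c z = mat (L * m) c (\<lambda>(r, j). z (s + r div m + j) $ (r mod m))"

definition append_cols :: "real mat \<Rightarrow> real mat \<Rightarrow> real mat" where
  "append_cols A B = four_block_mat A B (0\<^sub>m 0 (dim_col A)) (0\<^sub>m 0 (dim_col B))"

definition full_row_rank :: "real mat \<Rightarrow> bool" where
  "full_row_rank H \<longleftrightarrow> vec_space.rank (dim_row H) H = dim_row H"

text \<open>\<open>T\<close> is the number of recorded samples \<open>z 0, \<dots>, z (T - 1)\<close>.\<close>

definition persistently_exciting :: "nat \<Rightarrow> nat \<Rightarrow> nat \<Rightarrow> (nat \<Rightarrow> real Matrix.vec) \<Rightarrow> bool" where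
  "persistently_exciting m L T z \<longleftrightarrow> full_row_rank (hankel m 0 L (T + 1 - L) z)"

definition controllable :: "nat \<Rightarrow> nat \<Rightarrow> real mat \<Rightarrow> real mat \<Rightarrow> bool" where
  "controllable n m F G \<longleftrightarrow>
     full_row_rank (mat n (n * m) (\<lambda>(i, j). (F ^\<^sub>m (j div m) * G) $$ (i, j mod m)))"

text \<open>Assumptions of Willems' fundamental lemma for windows of length \<open>L\<close> of a system with \<open>n\<close>
  states, \<open>m\<close> inputs, state matrix \<open>F\<close> and input matrix \<open>G\<close>, for recorded inputs \<open>z\<close> and states
  \<open>x\<close>. The lemma is in use under either of two sets of assumptions, and either one is accepted:
  the inputs are persistently exciting of order \<open>L\<close> and the state-input data matrix has full row
  rank; or the system is controllable and the inputs are persistently exciting of order \<open>L + n\<close>.\<close>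

definition willems_assumptions ::
  "nat \<Rightarrow> nat \<Rightarrow> real mat \<Rightarrow> real mat \<Rightarrow> nat \<Rightarrow> nat
   \<Rightarrow> (nat \<Rightarrow> real Matrix.vec) \<Rightarrow> (nat \<Rightarrow> real Matrix.vec) \<Rightarrow> bool" where
  "willems_assumptions n m F G L T z x \<longleftrightarrow>
     (persistently_exciting m L T z \<and>
      full_row_rank (hankel n 0 1 (T + 1 - L) x @\<^sub>r hankel m 0 L (T + 1 - L) z)) \<or>
     (controllable n m F G \<and> persistently_exciting m (L + n) T z)"

section \<open>Multi-step prediction by the filter\<close>

text \<open>Time is relative to the start of the past window, where the filter state is \<open>xi\<close>. From step
  \<open>Lp\<close> on, the measured output is replaced by the predicted one (zero innovation).\<close>

primrec kf_pred_state ::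
  "real mat \<Rightarrow> real mat \<Rightarrow> real mat \<Rightarrow> real mat \<Rightarrow> real mat \<Rightarrow> nat \<Rightarrow> real Matrix.vec
   \<Rightarrow> (nat \<Rightarrow> real Matrix.vec) \<Rightarrow> (nat \<Rightarrow> real Matrix.vec) \<Rightarrow> nat \<Rightarrow> real Matrix.vec" where
  "kf_pred_state A B C D K Lp xi u y 0 = xi"
| "kf_pred_state A B C D K Lp xi u y (Suc k) =
     (let xh = kf_pred_state A B C D K Lp xi u y k
      in kf_step A B C D K xh (u k) (if k < Lp then y k else kf_output C D xh (u k)))"

definition kf_prediction ::
  "nat \<Rightarrow> nat \<Rightarrow> real mat \<Rightarrow> real mat \<Rightarrow> real mat \<Rightarrow> real mat \<Rightarrow> real mat \<Rightarrow> nat \<Rightarrow> nat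
   \<Rightarrow> real Matrix.vec \<Rightarrow> real Matrix.vec \<Rightarrow> real Matrix.vec \<Rightarrow> real Matrix.vec \<Rightarrow> real Matrix.vec" where
  "kf_prediction m p A B C D K Lp Lf xi uini yini uf =
     (let u = vec_block m (uini @\<^sub>v uf)
      in col_stack p Lf (\<lambda>i. kf_output C D
           (kf_pred_state A B C D K Lp xi u (vec_block p yini) (Lp + i)) (u (Lp + i))))"

end

theory Submission
  imports Defs
begin

text \<open>The filter in predictor form is a linear system with input \<open>(u, y)\<close>. The multi-step prediction is
  one of its trajectories: run the filter from \<open>xi\<close> with the given past data and the given future
  inputs, and let the future outputs be the predicted ones. Under the assumptions of Willems'
  fundamental lemma the recorded windows span all trajectories of the predictor, so some \<open>g\<close>
  combines the recorded windows of inputs, outputs and filter states into this particular one. Read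
  off block by block, this gives the equations for the past data and the future inputs, and
  \<open>Y\<^sub>f g\<close> is the prediction. The output of the filter is linear in its state and input, so the same
  \<open>g\<close> combines the recorded filter outputs into the predicted outputs. These agree with the combined
  measured outputs \<open>Y\<^sub>f g\<close>, hence \<open>E\<^sub>f g = 0\<close>.

  The argument is applied to each realisation for which the rank assumptions hold. It rests on
  \<open>willems_left_kernel\<close>, the algebraic core of the fundamental lemma, on
  \<open>willems_trajectory_comb\<close>, which provides \<open>g\<close>, and on \<open>innovation_null_space\<close>, which follows
  the filter along the combined trajectory.\<close>

section \<open>Full row rank, left kernels and surjectivity\<close>

text \<open>A maximal independent set of columns has as many members as there are rows, so these columns
  form an invertible square matrix, and \<open>q\<close> is orthogonal to all of them.\<close>

lemma full_row_rank_left_kernel: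
  assumes H: "H \<in> carrier_mat r c" and full: "full_row_rank H"
    and q: "q \<in> carrier_vec r" and orth: "\<And>j. j < c \<Longrightarrow> col H j \<bullet> q = 0"
  shows "q = 0\<^sub>v r"
proof -
  interpret vec_space "TYPE(real)" r .
  obtain S where S: "maximal S (\<lambda>T. T \<subseteq> set (cols H) \<and> lin_indpt T)"
    using maximal_exists_superset[of "set (cols H)" "\<lambda>T. T \<subseteq> set (cols H) \<and> lin_indpt T" "{}"]
    by (metis List.finite_set empty_subsetI finite_lin_indpt2 finite.emptyI empty_iff)
  have cardS: "card S = r"
    using rank_card_indpt[OF H S] full H unfolding full_row_rank_def by simp
  have Scols: "S \<subseteq> set (cols H)" and Sindep: "lin_indpt S"
    using S unfolding maximal_def by auto
  obtain bs where bs: "set bs = S" "distinct bs"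
    using finite_distinct_list finite_subset[OF Scols] by blast
  have len: "length bs = r" using bs cardS distinct_card by fastforce
  have bs_carrier: "set bs \<subseteq> carrier_vec r" using bs Scols H cols_dim by blast
  define Q where "Q = mat_of_cols r bs"
  have Q: "Q \<in> carrier_mat r r" and colsQ: "cols Q = bs"
    using len bs_carrier unfolding Q_def by auto
  have "rank Q = r"
    by (rule lin_indpt_full_rank[OF Q]) (use colsQ bs Sindep in auto)
  then have det: "det (transpose_mat Q) \<noteq> 0"
    using det_rank_iff[OF Q] det_transpose[OF Q] by simp
  have "transpose_mat Q *\<^sub>v q = 0\<^sub>v r"
  proof (rule eq_vecI)
    fix i assume i: "i < dim_vec (0\<^sub>v r :: real Matrix.vec)"
    then have "col Q i \<in> set (cols H)"
      using colsQ bs Scols len Q by (metis carrier_matD(2) cols_length cols_nth index_zero_vec(2) nth_mem subsetD)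
    then obtain j where "j < c" "col Q i = col H j"
      using H by (metis carrier_matD(2) cols_length cols_nth in_set_conv_nth)
    then show "(transpose_mat Q *\<^sub>v q) $ i = 0\<^sub>v r $ i"
      using orth i Q by simp
  qed (use Q in simp)
  then show ?thesis
    using det_0_iff_vec_prod_zero_field[of "transpose_mat Q" r] det Q q by auto
qed

text \<open>Over the reals the Gram matrix \<open>H H\<^sup>T\<close> has the same kernel as \<open>H\<^sup>T\<close>, because \<open>q \<bullet> H H\<^sup>T q\<close> is a sum
  of squares. The Gram matrix is therefore invertible, and \<open>H\<^sup>T\<close> times the solution of its linear
  system with right-hand side \<open>b\<close> is a preimage of \<open>b\<close>.\<close>

lemma trivial_left_kernel_surjective:
  fixes H :: "real mat"
  assumes H: "H \<in> carrier_mat r c"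
    and ker: "\<And>q. q \<in> carrier_vec r \<Longrightarrow> (\<And>j. j < c \<Longrightarrow> col H j \<bullet> q = 0) \<Longrightarrow> q = 0\<^sub>v r"
    and b: "b \<in> carrier_vec r"
  shows "\<exists>g \<in> carrier_vec c. H *\<^sub>v g = b"
proof -
  define G where "G = H * transpose_mat H"
  have G: "G \<in> carrier_mat r r" using H unfolding G_def by simp
  have "det G \<noteq> 0"
  proof
    assume "det G = 0"
    then obtain q where q: "q \<in> carrier_vec r" "q \<noteq> 0\<^sub>v r" and Gq: "G *\<^sub>v q = 0\<^sub>v r"
      using det_0_iff_vec_prod_zero_field[OF G] by blast
    define h where "h = transpose_mat H *\<^sub>v q"
    have h: "h \<in> carrier_vec c" using H q unfolding h_def by simp
    have "H *\<^sub>v h = 0\<^sub>v r" using Gq H q unfolding G_def h_def by simp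
    then have "h \<bullet> h = 0"
      using transpose_vec_mult_scalar[OF H h q(1)] q unfolding h_def by simp
    then have "h = 0\<^sub>v c" using conjugate_square_eq_0_vec[OF h] by (simp add: conjugate_vec_def vec_eq_iff)
    moreover have "h $ j = col H j \<bullet> q" if "j < c" for j
      using that H unfolding h_def by simp
    ultimately have "col H j \<bullet> q = 0" if "j < c" for j
      using that by (metis index_zero_vec(1))
    then show False using ker q by blast
  qed
  then obtain G' where G': "G' \<in> carrier_mat r r" "G * G' = 1\<^sub>m r"
    using det_non_zero_imp_unit[OF G, of "()"] unfolding Units_def ring_mat_def by auto
  have "H *\<^sub>v (transpose_mat H *\<^sub>v (G' *\<^sub>v b)) = G *\<^sub>v (G' *\<^sub>v b)"
    unfolding G_def by (rule assoc_mult_mat_vec[symmetric]) (use H G' b in auto)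
  also have "\<dots> = (G * G') *\<^sub>v b"
    by (rule assoc_mult_mat_vec[symmetric]) (use G G' b in auto)
  also have "\<dots> = b" using G' b by simp
  finally show ?thesis
    using H G' b by (intro bexI[of _ "transpose_mat H *\<^sub>v (G' *\<^sub>v b)"]) auto
qed

text \<open>The dependence is cut off at its last nonzero coefficient, so that it can be read as a recurrence
  of order \<open>d\<close> with an invertible leading coefficient.\<close>

lemma linear_dependence:
  fixes \<xi> :: "nat \<Rightarrow> real Matrix.vec"
  assumes "\<And>k. \<xi> k \<in> carrier_vec n"
  shows "\<exists>d \<alpha>. d \<le> n \<and> \<alpha> d \<noteq> 0 \<and> (\<forall>r<n. (\<Sum>k\<le>d. \<alpha> k * \<xi> k $ r) = 0)"
proof -
  \<comment> \<open>A zero row makes the matrix with the columns \<open>\<xi> 0, \<dots>, \<xi> n\<close> square and singular.\<close>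
  define Q where "Q = mat (Suc n) (Suc n) (\<lambda>(r, k). if r < n then \<xi> k $ r else 0)"
  have Q: "Q \<in> carrier_mat (Suc n) (Suc n)" unfolding Q_def by simp
  have "transpose_mat Q *\<^sub>v unit_vec (Suc n) n = 0\<^sub>v (Suc n)"
    by (rule eq_vecI) (auto simp: Q_def)
  then have "det (transpose_mat Q) = 0"
    using det_0_iff_vec_prod_zero_field[of "transpose_mat Q" "Suc n"] Q
    by (metis lessI transpose_carrier_mat unit_vec_carrier unit_vec_nonzero)
  then obtain a where a: "a \<in> carrier_vec (Suc n)" "a \<noteq> 0\<^sub>v (Suc n)" "Q *\<^sub>v a = 0\<^sub>v (Suc n)"
    using det_0_iff_vec_prod_zero_field[OF Q] det_transpose[OF Q] by auto
  define d where "d = Max {k. k \<le> n \<and> a $ k \<noteq> 0}"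
  have "{k. k \<le> n \<and> a $ k \<noteq> 0} \<noteq> {}"
    using a(1,2) by (auto simp: vec_eq_iff less_Suc_eq_le)
  then have d: "d \<le> n" "a $ d \<noteq> 0"
    using Max_in[of "{k. k \<le> n \<and> a $ k \<noteq> 0}"] unfolding d_def by auto
  have above: "a $ k = 0" if "d < k" "k \<le> n" for k
  proof (rule ccontr)
    assume "a $ k \<noteq> 0"
    then have "k \<le> d" using that(2) unfolding d_def by (intro Max_ge) auto
    then show False using that(1) by simp
  qed
  have "(\<Sum>k\<le>d. a $ k * \<xi> k $ r) = 0" if "r < n" for r
  proof -
    have "0 = (Q *\<^sub>v a) $ r" using a(3) that by simp
    also have "\<dots> = (\<Sum>k<Suc n. a $ k * \<xi> k $ r)"
      using that a(1) by (simp add: Q_def scalar_prod_def atLeast0LessThan mult.commute)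
    also have "\<dots> = (\<Sum>k\<le>d. a $ k * \<xi> k $ r)"
      unfolding lessThan_Suc_atMost
      by (rule sum.mono_neutral_right) (use d above in auto)
    finally show ?thesis by simp
  qed
  then have "d \<le> n \<and> a $ d \<noteq> 0 \<and> (\<forall>r<n. (\<Sum>k\<le>d. a $ k * \<xi> k $ r) = 0)"
    using d by blast
  then show ?thesis by (intro exI[of _ d] exI[of _ "\<lambda>k. a $ k"])
qed

section \<open>Block matrix algebra\<close>

lemma col_append_rows:
  assumes A: "A \<in> carrier_mat r1 c" and B: "B \<in> carrier_mat r2 c" and j: "j < c"
  shows "col (A @\<^sub>r B) j = col A j @\<^sub>v col B j"
proof -
  have "col (A @\<^sub>r B) j = col (four_block_mat A (0\<^sub>m r1 0) B (0\<^sub>m r2 0)) j"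
    using A B unfolding append_rows_def by simp
  also have "\<dots> = col A j @\<^sub>v col B j"
    by (rule col_four_block_mat) (use A B j in auto)
  finally show ?thesis .
qed

lemma append_cols_mult:
  assumes A: "A \<in> carrier_mat r c1" and B: "B \<in> carrier_mat r c2"
    and a: "a \<in> carrier_vec c1" and b: "b \<in> carrier_vec c2"
  shows "append_cols A B *\<^sub>v (a @\<^sub>v b) = A *\<^sub>v a + B *\<^sub>v b"
proof -
  have "append_cols A B *\<^sub>v (a @\<^sub>v b)
      = (A *\<^sub>v a + B *\<^sub>v b) @\<^sub>v (0\<^sub>m 0 c1 *\<^sub>v a + 0\<^sub>m 0 c2 *\<^sub>v b)"
    using A B unfolding append_cols_def
    by (simp add: four_block_mat_mult_vec[OF A B _ _ a b, of _ 0])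
  also have "\<dots> = A *\<^sub>v a + B *\<^sub>v b"
    using A B by (intro eq_vecI) auto
  finally show ?thesis .
qed

lemma mult_mat_vec_inner:
  fixes M :: "real mat"
  assumes M: "M \<in> carrier_mat r c" and v: "v \<in> carrier_vec c" and w: "w \<in> carrier_vec r"
  shows "(M *\<^sub>v v) \<bullet> w = v \<bullet> (transpose_mat M *\<^sub>v w)"
proof -
  have "(M *\<^sub>v v) \<bullet> w = w \<bullet> (M *\<^sub>v v)"
    by (rule comm_scalar_prod) (use M v w in auto)
  also have "\<dots> = (transpose_mat M *\<^sub>v w) \<bullet> v"
    by (rule transpose_vec_mult_scalar[OF M v w, symmetric])
  also have "\<dots> = v \<bullet> (transpose_mat M *\<^sub>v w)"
    by (rule comm_scalar_prod) (use M v w in auto)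
  finally show ?thesis .
qed

lemma pow_mat_add_exponents:
  assumes "F \<in> carrier_mat n n"
  shows "F ^\<^sub>m (k + i) = F ^\<^sub>m k * F ^\<^sub>m i"
  using assms by (induction i) (auto simp: assoc_mult_mat[of _ n n _ n _ n])

section \<open>Stacked vectors and Hankel matrices\<close>

lemma block_index_less:
  fixes i r m L :: nat
  assumes "i < L" "r < m"
  shows "i * m + r < L * m"
proof -
  have "i * m + r < Suc i * m" using assms by simp
  also have "\<dots> \<le> L * m" using assms by (intro mult_le_mono1) simp
  finally show ?thesis .
qed

lemma col_stack_carrier [simp]: "col_stack m L z \<in> carrier_vec (L * m)"
  unfolding col_stack_def by simp

lemma vec_block_carrier [simp]: "vec_block m v i \<in> carrier_vec m"
  unfolding vec_block_def by simp

lemma hankel_carrier [simp]: "hankel m s L c z \<in> carrier_mat (L * m) c"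
  unfolding hankel_def by simp

lemma vec_block_col_stack:
  assumes "i < L" "z i \<in> carrier_vec m"
  shows "vec_block m (col_stack m L z) i = z i"
  using assms by (intro eq_vecI) (auto simp: vec_block_def col_stack_def block_index_less)

lemma col_stack_vec_block:
  assumes "b \<in> carrier_vec (L * m)"
  shows "col_stack m L (vec_block m b) = b"
proof (rule eq_vecI)
  fix r assume "r < dim_vec b"
  then have r: "r < L * m" using assms by simp
  then have "0 < m" by (cases m) auto
  then show "col_stack m L (vec_block m b) $ r = b $ r"
    using r by (simp add: col_stack_def vec_block_def)
qed (use assms in \<open>simp add: col_stack_def\<close>)

lemma col_stack_cong:
  assumes "\<And>i. i < L \<Longrightarrow> f i = h i"
  shows "col_stack m L f = col_stack m L h"
  using assms by (intro eq_vecI) (auto simp: col_stack_def less_mult_imp_div_less)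

lemma vec_block_append_left:
  assumes "a \<in> carrier_vec (L * m)" "i < L"
  shows "vec_block m (a @\<^sub>v b) i = vec_block m a i"
  using assms block_index_less[of i L _ m] 
  by (intro eq_vecI) (auto simp: vec_block_def trans_less_add1)

lemma vec_block_append_right:
  assumes "a \<in> carrier_vec (L * m)" "b \<in> carrier_vec (L' * m)" "i < L'"
  shows "vec_block m (a @\<^sub>v b) (L + i) = vec_block m b i"
  using assms block_index_less[of i L' _ m]
  by (intro eq_vecI) (auto simp: vec_block_def distrib_right)

lemma col_hankel_inner:
  assumes z: "\<And>k. z k \<in> carrier_vec m" and q: "q \<in> carrier_vec (L * m)" and j: "j < c"
  shows "col (hankel m s L c z) j \<bullet> q = (\<Sum>i<L. z (s + i + j) \<bullet> vec_block m q i)"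
proof -
  let ?f = "\<lambda>r. z (s + r div m + j) $ (r mod m) * q $ r"
  have "col (hankel m s L c z) j \<bullet> q = sum ?f {..<L * m}"
    using q j by (simp add: scalar_prod_def hankel_def atLeast0LessThan)
  also have "\<dots> = (\<Sum>i<L. sum ?f {i * m..<i * m + m})"
    by (rule sum.nat_group[symmetric])
  also have "\<dots> = (\<Sum>i<L. z (s + i + j) \<bullet> vec_block m q i)"
  proof (rule sum.cong[OF refl])
    fix i
    have "sum ?f {i * m..<i * m + m} = (\<Sum>r<m. ?f (r + i * m))"
      using sum.shift_bounds_nat_ivl[of ?f 0 "i * m" m] by (simp add: atLeast0LessThan add.commute)
    also have "\<dots> = z (s + i + j) \<bullet> vec_block m q i"
      by (simp add: scalar_prod_def vec_block_def atLeast0LessThan add.commute)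
    finally show "sum ?f {i * m..<i * m + m} = z (s + i + j) \<bullet> vec_block m q i" .
  qed
  finally show ?thesis .
qed

text \<open>For a weight vector \<open>g\<close> on the columns, \<open>data_comb m c g z i\<close> is the sample at relative time \<open>i\<close> of
  the weighted superposition of the \<open>c\<close> windows of \<open>z\<close> that start at the times \<open>0, \<dots>, c - 1\<close>.\<close>

definition data_comb :: "nat \<Rightarrow> nat \<Rightarrow> real Matrix.vec \<Rightarrow> (nat \<Rightarrow> real Matrix.vec) \<Rightarrow> nat \<Rightarrow> real Matrix.vec" where
  "data_comb m c g z i = Matrix.vec m (\<lambda>r. \<Sum>j<c. z (i + j) $ r * g $ j)"

lemma data_comb_carrier [simp]: "data_comb m c g z i \<in> carrier_vec m"
  unfolding data_comb_def by simp

text \<open>Combining the columns of a Hankel matrix superposes the recorded windows. This turns matrix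
  equations for \<open>g\<close> into statements about one trajectory.\<close>

lemma hankel_mult:
  assumes "g \<in> carrier_vec c"
  shows "hankel m s L c z *\<^sub>v g = col_stack m L (\<lambda>i. data_comb m c g z (s + i))"
proof (rule eq_vecI)
  fix r assume "r < dim_vec (col_stack m L (\<lambda>i. data_comb m c g z (s + i)))"
  then have r: "r < L * m" by (simp add: col_stack_def)
  then have "0 < m" by (cases m) auto
  then show "(hankel m s L c z *\<^sub>v g) $ r = col_stack m L (\<lambda>i. data_comb m c g z (s + i)) $ r"
    using r assms
    by (simp add: hankel_def col_stack_def data_comb_def scalar_prod_def atLeast0LessThan)
qed (simp add: hankel_def col_stack_def)

lemma data_comb_append:
  assumes u: "\<And>k. u k \<in> carrier_vec m" and y: "\<And>k. y k \<in> carrier_vec p"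
  shows "data_comb (m + p) c g (\<lambda>k. u k @\<^sub>v y k) i = data_comb m c g u i @\<^sub>v data_comb p c g y i"
proof (rule eq_vecI)
  fix r assume r: "r < dim_vec (data_comb m c g u i @\<^sub>v data_comb p c g y i)"
  have [simp]: "dim_vec (u k) = m" "dim_vec (y k) = p" for k
    using u[of k] y[of k] by auto
  show "data_comb (m + p) c g (\<lambda>k. u k @\<^sub>v y k) i $ r
      = (data_comb m c g u i @\<^sub>v data_comb p c g y i) $ r"
    using r by (cases "r < m") (simp_all add: data_comb_def)
qed (simp add: data_comb_def)

lemma data_comb_mult_mat_vec:
  assumes Q: "Q \<in> carrier_mat m s" and z: "\<And>k. z k \<in> carrier_vec s"
  shows "data_comb m c g (\<lambda>k. Q *\<^sub>v z k) i = Q *\<^sub>v data_comb s c g z i"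
proof (rule eq_vecI)
  fix r assume "r < dim_vec (Q *\<^sub>v data_comb s c g z i)"
  then have r: "r < m" using Q by simp
  have [simp]: "dim_vec (z k) = s" for k using z[of k] by auto
  have "data_comb m c g (\<lambda>k. Q *\<^sub>v z k) i $ r
      = (\<Sum>j<c. \<Sum>l<s. Matrix.row Q r $ l * (z (i + j) $ l * g $ j))"
    using r Q by (simp add: data_comb_def scalar_prod_def atLeast0LessThan sum_distrib_right mult.assoc)
  also have "\<dots> = (\<Sum>l<s. Matrix.row Q r $ l * (\<Sum>j<c. z (i + j) $ l * g $ j))"
    by (subst sum.swap) (simp add: sum_distrib_left)
  also have "\<dots> = (Q *\<^sub>v data_comb s c g z i) $ r"
    using r Q by (simp add: data_comb_def scalar_prod_def atLeast0LessThan)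
  finally show "data_comb m c g (\<lambda>k. Q *\<^sub>v z k) i $ r = (Q *\<^sub>v data_comb s c g z i) $ r" .
qed (use Q in \<open>simp add: data_comb_def\<close>)

lemma data_comb_add:
  assumes "\<And>k. z k \<in> carrier_vec m" "\<And>k. w k \<in> carrier_vec m"
  shows "data_comb m c g (\<lambda>k. z k + w k) i = data_comb m c g z i + data_comb m c g w i"
proof -
  have [simp]: "dim_vec (z k) = m" "dim_vec (w k) = m" for k
    using assms(1)[of k] assms(2)[of k] by auto
  show ?thesis by (intro eq_vecI) (auto simp: data_comb_def distrib_right sum.distrib)
qed

lemma data_comb_diff:
  assumes "\<And>k. z k \<in> carrier_vec m" "\<And>k. w k \<in> carrier_vec m"
  shows "data_comb m c g (\<lambda>k. z k - w k) i = data_comb m c g z i - data_comb m c g w i"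
proof -
  have [simp]: "dim_vec (z k) = m" "dim_vec (w k) = m" for k
    using assms(1)[of k] assms(2)[of k] by auto
  show ?thesis by (intro eq_vecI) (auto simp: data_comb_def left_diff_distrib sum_subtractf)
qed

section \<open>Left kernels of data and controllability matrices\<close>

lemma persistently_exciting_coeffs_zero:
  assumes pe: "persistently_exciting m l T z"
    and z: "\<And>k. z k \<in> carrier_vec m" and \<rho>: "\<And>i. \<rho> i \<in> carrier_vec m"
    and orth: "\<And>j. j < T + 1 - l \<Longrightarrow> (\<Sum>i<l. z (i + j) \<bullet> \<rho> i) = 0"
    and i: "i < l"
  shows "\<rho> i = 0\<^sub>v m"
proof -
  let ?q = "col_stack m l \<rho>"
  have block: "vec_block m ?q k = \<rho> k" if "k < l" for k
    using that \<rho> by (rule vec_block_col_stack)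
  have "?q = 0\<^sub>v (l * m)"
  proof (rule full_row_rank_left_kernel)
    show "full_row_rank (hankel m 0 l (T + 1 - l) z)"
      using pe unfolding persistently_exciting_def .
    show "col (hankel m 0 l (T + 1 - l) z) j \<bullet> ?q = 0" if "j < T + 1 - l" for j
    proof -
      have "col (hankel m 0 l (T + 1 - l) z) j \<bullet> ?q = (\<Sum>i<l. z (0 + i + j) \<bullet> vec_block m ?q i)"
        using z that by (intro col_hankel_inner) simp_all
      also have "\<dots> = (\<Sum>i<l. z (i + j) \<bullet> \<rho> i)" by (simp add: block)
      finally show ?thesis using orth[OF that] by simp
    qed
  qed simp_all
  then have "\<rho> i = vec_block m (0\<^sub>v (l * m)) i" using block[OF i] by simp
  also have "\<dots> = 0\<^sub>v m" using i by (intro eq_vecI) (auto simp: vec_block_def block_index_less)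
  finally show ?thesis .
qed

lemma controllable_left_kernel:
  assumes F: "F \<in> carrier_mat n n" and G: "G \<in> carrier_mat n m"
    and ctrl: "controllable n m F G" and \<xi>: "\<xi> \<in> carrier_vec n"
    and zero: "\<And>i. i < n \<Longrightarrow> transpose_mat G *\<^sub>v (transpose_mat (F ^\<^sub>m i) *\<^sub>v \<xi>) = 0\<^sub>v m"
  shows "\<xi> = 0\<^sub>v n"
proof -
  let ?R = "mat n (n * m) (\<lambda>(i, j). (F ^\<^sub>m (j div m) * G) $$ (i, j mod m))"
  show ?thesis
  proof (rule full_row_rank_left_kernel[of ?R n "n * m"])
    show "full_row_rank ?R" using ctrl unfolding controllable_def .
    fix j assume j: "j < n * m"
    then have m: "0 < m" by (cases m) auto
    have jd: "j div m < n" using j by (simp add: less_mult_imp_div_less)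
    let ?P = "F ^\<^sub>m (j div m)"
    have P: "?P \<in> carrier_mat n n" using F by simp
    have "col ?R j = col (?P * G) (j mod m)"
      using j m P G by (intro eq_vecI) auto
    then have "col ?R j \<bullet> \<xi> = col (?P * G) (j mod m) \<bullet> \<xi>" by simp
    also have "\<dots> = (transpose_mat (?P * G) *\<^sub>v \<xi>) $ (j mod m)"
      using m P G by simp
    also have "transpose_mat (?P * G) *\<^sub>v \<xi> = transpose_mat G *\<^sub>v (transpose_mat ?P *\<^sub>v \<xi>)"
      using transpose_mult[OF P G] P G \<xi> by (simp add: assoc_mult_mat_vec[of _ m n _ n])
    finally show "col ?R j \<bullet> \<xi> = 0" using zero[OF jd] m by simp
  qed (use \<xi> in auto)
qed

section \<open>The fundamental lemma of Willems\<close>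

text \<open>A linear recurrence determines each value from the earlier ones. The value 0 outside the range
  \<open>d \<le> t + k\<close> encodes zero initial values at negative times, so the solution vanishes throughout.\<close>

lemma linear_recurrence_zero:
  fixes f \<alpha> :: "nat \<Rightarrow> real"
  assumes "\<alpha> d \<noteq> 0"
    and rec: "\<And>t. (\<Sum>k\<le>d. \<alpha> k * (if d \<le> t + k then f (t + k - d) else 0)) = 0"
  shows "f t = 0"
proof (induction t rule: less_induct)
  case (less t)
  have "(\<Sum>k\<le>d. \<alpha> k * (if d \<le> t + k then f (t + k - d) else 0))
      = (\<Sum>k\<in>{d}. \<alpha> k * (if d \<le> t + k then f (t + k - d) else 0))"
    by (rule sum.mono_neutral_right) (auto intro!: less.IH)
  then show ?case using rec[of t] assms(1) by simp
qed

text \<open>If \<open>\<xi> 0\<close> and the coefficients \<open>\<zeta> 0, \<dots>, \<zeta> (L - 1)\<close>, listed from the latest input to the earliest,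
  annihilate each of the first \<open>c\<close> states together with the \<open>L\<close> inputs from its time on, then
  substituting the system equation into this relation one step later eliminates the later state. The
  result is again such a relation, with one more input: the state coefficient is multiplied by
  \<open>F\<^sup>T\<close>, and \<open>G\<^sup>T \<xi> k\<close> is added at the earliest position. In the reversed numbering all shifted relations are prefixes of one and the same
  sequence \<open>\<zeta>\<close>.\<close>

lemma willems_annihilator_shift:
  fixes F G :: "real mat"
  assumes F: "F \<in> carrier_mat n n" and G: "G \<in> carrier_mat n m"
    and z: "\<And>k. z k \<in> carrier_vec m" and x: "\<And>k. x k \<in> carrier_vec n"
    and step: "\<And>k. x (Suc k) = F *\<^sub>v x k + G *\<^sub>v z k"
    and \<xi>: "\<And>k. \<xi> k \<in> carrier_vec n" and \<xi>_Suc: "\<And>k. \<xi> (Suc k) = transpose_mat F *\<^sub>v \<xi> k"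
    and \<zeta>: "\<And>k. \<zeta> (L + k) = transpose_mat G *\<^sub>v \<xi> k"
    and orth: "\<And>j. j < c \<Longrightarrow> x j \<bullet> \<xi> 0 + (\<Sum>t<L. z (j + (L - 1 - t)) \<bullet> \<zeta> t) = 0"
    and j: "j + k < c"
  shows "x j \<bullet> \<xi> k + (\<Sum>t<L + k. z (j + (L + k - 1 - t)) \<bullet> \<zeta> t) = 0"
  using j
proof (induction k arbitrary: j)
  case 0
  then show ?case using orth by simp
next
  case (Suc k)
  have "x (Suc j) \<bullet> \<xi> k = (F *\<^sub>v x j) \<bullet> \<xi> k + (G *\<^sub>v z j) \<bullet> \<xi> k"
    unfolding step by (rule add_scalar_prod_distrib) (use F G x z \<xi> in auto)
  also have "(F *\<^sub>v x j) \<bullet> \<xi> k = x j \<bullet> \<xi> (Suc k)"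
    unfolding \<xi>_Suc
    by (rule mult_mat_vec_inner[OF F x \<xi>])
  also have "(G *\<^sub>v z j) \<bullet> \<xi> k = z j \<bullet> \<zeta> (L + k)"
    unfolding \<zeta>
    by (rule mult_mat_vec_inner[OF G z \<xi>])
  finally have "x (Suc j) \<bullet> \<xi> k = x j \<bullet> \<xi> (Suc k) + z j \<bullet> \<zeta> (L + k)" .
  moreover have "(\<Sum>t<L + k. z (Suc j + (L + k - 1 - t)) \<bullet> \<zeta> t)
      = (\<Sum>t<L + k. z (j + (L + Suc k - 1 - t)) \<bullet> \<zeta> t)"
    by (rule sum.cong[OF refl]) (simp add: Suc_diff_Suc)
  ultimately show ?case using Suc.IH[of "Suc j"] Suc.prems by simp
qed

text \<open>Let \<open>(a, \<eta>)\<close> be in the left kernel of the state-input data matrix, and let \<open>\<zeta>\<close> be its sequence of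
  shifted coefficients. Among the \<open>n + 1\<close> vectors \<open>\<xi> k = (F\<^sup>T)\<^sup>k a\<close> there is a dependence \<open>\<alpha>\<close>. Combining
  the shifted relations with the weights \<open>\<alpha>\<close> cancels the state and leaves a relation between \<open>L + n\<close>
  consecutive inputs only, whose coefficients vanish by persistency of excitation of order \<open>L + n\<close>.
  These coefficients are the \<open>\<alpha>\<close>-combinations of shifts of \<open>\<zeta>\<close>, so \<open>\<zeta>\<close> satisfies the recurrence \<open>\<alpha>\<close>
  with zero initial values at first; from time \<open>L + d\<close> on it satisfies it because \<open>\<alpha>\<close> is a dependence
  of the \<open>\<xi> k\<close>. Hence \<open>\<zeta> = 0\<close>. Its first \<open>L\<close> members are the \<open>\<eta> i\<close>, and the others are the
  \<open>G\<^sup>T (F\<^sup>T)\<^sup>k a\<close>, whose vanishing forces \<open>a = 0\<close> by controllability. A dependence among the \<open>\<xi> k\<close>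
  takes the place that the Cayley-Hamilton theorem has in the usual form of this argument.\<close>

lemma willems_left_kernel:
  assumes F: "F \<in> carrier_mat n n" and G: "G \<in> carrier_mat n m"
    and z: "\<And>k. z k \<in> carrier_vec m" and x: "\<And>k. x k \<in> carrier_vec n"
    and step: "\<And>k. x (Suc k) = F *\<^sub>v x k + G *\<^sub>v z k"
    and ctrl: "controllable n m F G" and pe: "persistently_exciting m (L + n) T z"
    and a: "a \<in> carrier_vec n" and \<eta>: "\<And>i. \<eta> i \<in> carrier_vec m"
    and orth: "\<And>j. j < T + 1 - L \<Longrightarrow> x j \<bullet> a + (\<Sum>i<L. z (i + j) \<bullet> \<eta> i) = 0"
  shows "a = 0\<^sub>v n \<and> (\<forall>i<L. \<eta> i = 0\<^sub>v m)"
proof -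
  define \<xi> where "\<xi> k = transpose_mat (F ^\<^sub>m k) *\<^sub>v a" for k
  define \<zeta> where "\<zeta> t = (if t < L then \<eta> (L - 1 - t) else transpose_mat G *\<^sub>v \<xi> (t - L))" for t
  have Fpow: "F ^\<^sub>m k \<in> carrier_mat n n" for k using F by simp
  have \<xi>: "\<xi> k \<in> carrier_vec n" for k
    unfolding \<xi>_def by (rule mult_mat_vec_carrier[of _ n n]) (use Fpow a in auto)
  have \<zeta>: "\<zeta> t \<in> carrier_vec m" for t
    unfolding \<zeta>_def using \<eta> mult_mat_vec_carrier[of "transpose_mat G" m n] G \<xi> by auto
  have dim_\<xi>: "dim_vec (\<xi> k) = n" and dim_\<zeta>: "dim_vec (\<zeta> k) = m" for k
    using \<xi>[of k] \<zeta>[of k] by auto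
  have \<xi>_add: "\<xi> (k + i) = transpose_mat (F ^\<^sub>m i) *\<^sub>v \<xi> k" for i k
  proof -
    have "F ^\<^sub>m (k + i) = F ^\<^sub>m k * F ^\<^sub>m i" using F by (simp add: pow_mat_add_exponents)
    then show ?thesis
      using transpose_mult[OF Fpow Fpow, of k i] Fpow a
      unfolding \<xi>_def by (simp add: assoc_mult_mat_vec[of _ n n _ n])
  qed
  have orth0: "x j \<bullet> \<xi> 0 + (\<Sum>t<L. z (j + (L - 1 - t)) \<bullet> \<zeta> t) = 0" if "j < T + 1 - L" for j
  proof -
    have "(\<Sum>t<L. z (j + (L - 1 - t)) \<bullet> \<zeta> t) = (\<Sum>t<L. z (L - Suc t + j) \<bullet> \<eta> (L - Suc t))"
      by (rule sum.cong) (auto simp: \<zeta>_def add.commute)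
    also have "\<dots> = (\<Sum>i<L. z (i + j) \<bullet> \<eta> i)"
      by (rule sum.nat_diff_reindex)
    finally show ?thesis using orth[OF that] F a by (simp add: \<xi>_def)
  qed
  have shifted: "(\<Sum>s<L + k. z (s + j) \<bullet> \<zeta> (L + k - 1 - s)) = - (x j \<bullet> \<xi> k)"
    if "j + k < T + 1 - L" for j k
  proof -
    have "x j \<bullet> \<xi> k + (\<Sum>t<L + k. z (j + (L + k - 1 - t)) \<bullet> \<zeta> t) = 0"
    proof (rule willems_annihilator_shift[of F n G m z x \<xi> \<zeta> L "T + 1 - L"])
      show "\<xi> (Suc i) = transpose_mat F *\<^sub>v \<xi> i" for i using \<xi>_add[of i 1] F by simp
      show "\<zeta> (L + i) = transpose_mat G *\<^sub>v \<xi> i" for i unfolding \<zeta>_def by simp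
    qed (use F G z x step \<xi> orth0 that in auto)
    moreover have "(\<Sum>s<L + k. z (s + j) \<bullet> \<zeta> (L + k - 1 - s))
        = (\<Sum>t<L + k. z (L + k - Suc t + j) \<bullet> \<zeta> (L + k - 1 - (L + k - Suc t)))"
      by (rule sum.nat_diff_reindex[symmetric])
    moreover have "\<dots> = (\<Sum>t<L + k. z (j + (L + k - 1 - t)) \<bullet> \<zeta> t)"
      by (rule sum.cong) (auto simp: add.commute)
    ultimately show ?thesis by linarith
  qed
  obtain d \<alpha> where "d \<le> n \<and> \<alpha> d \<noteq> 0 \<and> (\<forall>r<n. (\<Sum>k\<le>d. \<alpha> k * \<xi> k $ r) = 0)"
    using linear_dependence[of \<xi> n, OF \<xi>] by (elim exE) (rule that)
  then have d: "d \<le> n" "\<alpha> d \<noteq> 0"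
    and dep: "r < n \<Longrightarrow> (\<Sum>k\<le>d. \<alpha> k * \<xi> k $ r) = 0" for r by auto
  \<comment> \<open>Linear functionals of the states inherit the dependence; this serves both for the
    combined relation and for the late part of the recurrence.\<close>
  have dep_linear: "(\<Sum>k\<le>d. \<alpha> k * (b \<bullet> \<xi> k)) = 0" if "b \<in> carrier_vec n" for b
  proof -
    have "(\<Sum>k\<le>d. \<alpha> k * (b \<bullet> \<xi> k)) = (\<Sum>k\<le>d. \<Sum>r<n. b $ r * (\<alpha> k * \<xi> k $ r))"
      by (simp add: scalar_prod_def atLeast0LessThan sum_distrib_left dim_\<xi> mult_ac)
    also have "\<dots> = (\<Sum>r<n. b $ r * (\<Sum>k\<le>d. \<alpha> k * \<xi> k $ r))"
      by (subst sum.swap) (simp add: sum_distrib_left)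
    finally show ?thesis using dep by simp
  qed
  \<comment> \<open>\<open>\<rho> s\<close> is the coefficient of the input at relative time \<open>s\<close> in the combined relation.\<close>
  define \<rho> where "\<rho> s = Matrix.vec m (\<lambda>r. \<Sum>k\<le>d. \<alpha> k *
      (if s < L + k then \<zeta> (L + k - 1 - s) $ r else 0))" for s
  have \<rho>_zero: "\<rho> s = 0\<^sub>v m" if "s < L + n" for s
  proof (rule persistently_exciting_coeffs_zero[OF pe z _ _ that])
    fix j assume j: "j < T + 1 - (L + n)"
    let ?term = "\<lambda>k s. if s < L + k then z (s + j) \<bullet> \<zeta> (L + k - 1 - s) else 0"
    have "(\<Sum>s<L + n. z (s + j) \<bullet> \<rho> s) = (\<Sum>s<L + n. \<Sum>k\<le>d. \<alpha> k * ?term k s)"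
    proof (rule sum.cong[OF refl])
      fix s
      have "z (s + j) \<bullet> \<rho> s = (\<Sum>k\<le>d. \<Sum>r<m. \<alpha> k *
          (z (s + j) $ r * (if s < L + k then \<zeta> (L + k - 1 - s) $ r else 0)))"
        unfolding \<rho>_def
        by (subst sum.swap) (simp add: scalar_prod_def atLeast0LessThan sum_distrib_left mult_ac)
      also have "\<dots> = (\<Sum>k\<le>d. \<alpha> k * ?term k s)"
        by (intro sum.cong[OF refl])
          (auto simp: scalar_prod_def atLeast0LessThan sum_distrib_left dim_\<zeta>)
      finally show "z (s + j) \<bullet> \<rho> s = (\<Sum>k\<le>d. \<alpha> k * ?term k s)" .
    qed
    also have "\<dots> = (\<Sum>k\<le>d. \<alpha> k * (\<Sum>s<L + n. ?term k s))"
      by (subst sum.swap) (simp add: sum_distrib_left)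
    also have "\<dots> = (\<Sum>k\<le>d. \<alpha> k * (- (x j \<bullet> \<xi> k)))"
    proof (rule sum.cong[OF refl])
      fix k assume "k \<in> {..d}"
      then have k: "k \<le> n" using d by simp
      have "(\<Sum>s<L + n. ?term k s) = (\<Sum>s<L + k. ?term k s)"
        by (rule sum.mono_neutral_right) (use k in auto)
      also have "\<dots> = - (x j \<bullet> \<xi> k)"
        using shifted[of j k] j k by simp
      finally show "\<alpha> k * (\<Sum>s<L + n. ?term k s) = \<alpha> k * (- (x j \<bullet> \<xi> k))" by simp
    qed
    also have "\<dots> = 0" using dep_linear[OF x] by (simp add: sum_negf)
    finally show "(\<Sum>s<L + n. z (s + j) \<bullet> \<rho> s) = 0" .
  qed (simp add: \<rho>_def)
  have \<zeta>_zero: "\<zeta> t = 0\<^sub>v m" for t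
  proof (rule eq_vecI)
    fix r assume "r < dim_vec (0\<^sub>v m :: real Matrix.vec)"
    then have r: "r < m" by simp
    have "\<zeta> t $ r = 0"
    proof (rule linear_recurrence_zero[of \<alpha> d "\<lambda>t. \<zeta> t $ r", OF d(2)])
      fix t
      show "(\<Sum>k\<le>d. \<alpha> k * (if d \<le> t + k then \<zeta> (t + k - d) $ r else 0)) = 0"
      proof (cases "t < L + d")
        case True
        \<comment> \<open>Early part: the recurrence at \<open>t\<close> is the vanishing of the coefficient at position \<open>s\<close>.\<close>
        define s where "s = L + d - 1 - t"
        have s: "s < L + n" using True d unfolding s_def by simp
        have "(\<Sum>k\<le>d. \<alpha> k * (if d \<le> t + k then \<zeta> (t + k - d) $ r else 0))
            = (\<Sum>k\<le>d. \<alpha> k * (if s < L + k then \<zeta> (L + k - 1 - s) $ r else 0))"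
        proof (rule sum.cong[OF refl])
          fix k
          have "d \<le> t + k \<longleftrightarrow> s < L + k" using True unfolding s_def by auto
          moreover have "t + k - d = L + k - 1 - s" if "d \<le> t + k"
            using True that unfolding s_def by auto
          ultimately show "\<alpha> k * (if d \<le> t + k then \<zeta> (t + k - d) $ r else 0)
              = \<alpha> k * (if s < L + k then \<zeta> (L + k - 1 - s) $ r else 0)" by auto
        qed
        also have "\<dots> = \<rho> s $ r" using r unfolding \<rho>_def by simp
        finally show ?thesis using \<rho>_zero[OF s] r by simp
      next
        case False
        \<comment> \<open>Late part: only members of the form \<open>G\<^sup>T \<xi> k\<close> occur, where \<open>\<alpha>\<close> is a dependence.\<close>
        define i where "i = t - L - d"
        define P where "P = transpose_mat G * transpose_mat (F ^\<^sub>m i)"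
        have P: "P \<in> carrier_mat m n" using G Fpow unfolding P_def by auto
        have "(if d \<le> t + k then \<zeta> (t + k - d) $ r else 0) = Matrix.row P r \<bullet> \<xi> k" for k
        proof -
          have "t + k - d = L + (k + i)" and dt: "d \<le> t + k" using False unfolding i_def by auto
          then have "\<zeta> (t + k - d) = transpose_mat G *\<^sub>v \<xi> (k + i)" unfolding \<zeta>_def by simp
          also have "\<dots> = P *\<^sub>v \<xi> k"
            unfolding P_def \<xi>_add
            by (rule assoc_mult_mat_vec[of _ m n _ n, symmetric]) (simp_all add: G Fpow \<xi>)
          finally show ?thesis using dt P r by simp
        qed
        then show ?thesis using dep_linear[of "Matrix.row P r"] P r by simp
      qed
    qed
    then show "\<zeta> t $ r = 0\<^sub>v m $ r" using r by simp
  qed (simp add: dim_\<zeta>)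
  have "\<eta> i = 0\<^sub>v m" if "i < L" for i
    using \<zeta>_zero[of "L - 1 - i"] that unfolding \<zeta>_def by (simp split: if_splits)
  moreover have "a = 0\<^sub>v n"
  proof (rule controllable_left_kernel[OF F G ctrl a])
    fix i
    show "transpose_mat G *\<^sub>v (transpose_mat (F ^\<^sub>m i) *\<^sub>v a) = 0\<^sub>v m"
      using \<zeta>_zero[of "L + i"] unfolding \<zeta>_def \<xi>_def by simp
  qed
  ultimately show ?thesis by blast
qed

text \<open>Either form of the rank assumptions makes the left kernel of the state-input data matrix trivial,
  so its columns generate every pair of an initial state and a window of inputs.\<close>

lemma willems_trajectory_comb:
  assumes F: "F \<in> carrier_mat n n" and G: "G \<in> carrier_mat n m"
    and z: "\<And>k. z k \<in> carrier_vec m" and x: "\<And>k. x k \<in> carrier_vec n"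
    and step: "\<And>k. x (Suc k) = F *\<^sub>v x k + G *\<^sub>v z k"
    and willems: "willems_assumptions n m F G L T z x"
    and x0: "x0 \<in> carrier_vec n" and z': "\<And>i. z' i \<in> carrier_vec m"
    and c: "c = T + 1 - L"
  shows "\<exists>g \<in> carrier_vec c. data_comb n c g x 0 = x0 \<and> (\<forall>i<L. data_comb m c g z i = z' i)"
proof -
  define X where "X = hankel n 0 1 c x"
  define Z where "Z = hankel m 0 L c z"
  have X: "X \<in> carrier_mat n c" unfolding X_def using hankel_carrier[of n 0 1 c x] by simp
  have Z: "Z \<in> carrier_mat (L * m) c" unfolding Z_def by simp
  have H: "X @\<^sub>r Z \<in> carrier_mat (n + L * m) c" using X Z by (rule carrier_append_rows)
  have ker: "q = 0\<^sub>v (n + L * m)"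
    if q: "q \<in> carrier_vec (n + L * m)" and orth: "\<And>j. j < c \<Longrightarrow> col (X @\<^sub>r Z) j \<bullet> q = 0" for q
    using willems unfolding willems_assumptions_def
  proof (elim disjE conjE)
    assume "full_row_rank (hankel n 0 1 (T + 1 - L) x @\<^sub>r hankel m 0 L (T + 1 - L) z)"
    then have "full_row_rank (X @\<^sub>r Z)" unfolding X_def Z_def c .
    from full_row_rank_left_kernel[OF H this q orth] show ?thesis .
  next
    assume ctrl: "controllable n m F G" and pe: "persistently_exciting m (L + n) T z"
    define a where "a = vec_first q n"
    define b where "b = vec_last q (L * m)"
    have a: "a \<in> carrier_vec n" and b: "b \<in> carrier_vec (L * m)" and q_split: "q = a @\<^sub>v b"
      using q unfolding a_def b_def by auto
    have orth_blocks: "x j \<bullet> a + (\<Sum>i<L. z (i + j) \<bullet> vec_block m b i) = 0" if "j < T + 1 - L" for j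
    proof -
      have j: "j < c" using that unfolding c .
      have "col X j = x j"
        using j x[of j] unfolding X_def by (intro eq_vecI) (auto simp: hankel_def)
      moreover have "col (X @\<^sub>r Z) j \<bullet> q = col X j \<bullet> a + col Z j \<bullet> b"
        unfolding q_split col_append_rows[OF X Z j]
        by (rule scalar_prod_append) (use X Z a b j in auto)
      moreover have "col Z j \<bullet> b = (\<Sum>i<L. z (0 + i + j) \<bullet> vec_block m b i)"
        unfolding Z_def using z b j by (rule col_hankel_inner)
      ultimately show ?thesis using orth[OF j] by simp
    qed
    have "a = 0\<^sub>v n \<and> (\<forall>i<L. vec_block m b i = 0\<^sub>v m)"
      by (rule willems_left_kernel[OF F G z x step ctrl pe a vec_block_carrier orth_blocks])
    then have a0: "a = 0\<^sub>v n" and b0: "\<forall>i<L. vec_block m b i = 0\<^sub>v m" by simp_all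
    have "b = 0\<^sub>v (L * m)"
    proof (rule eq_vecI)
      fix r assume "r < dim_vec (0\<^sub>v (L * m) :: real Matrix.vec)"
      then have r: "r < L * m" by simp
      then have m: "0 < m" by (cases m) auto
      have "b $ r = vec_block m b (r div m) $ (r mod m)"
        using m by (simp add: vec_block_def)
      then show "b $ r = 0\<^sub>v (L * m) $ r"
        using b0 r m by (simp add: less_mult_imp_div_less)
    qed (use b in simp)
    then show ?thesis using a0 unfolding q_split by (intro eq_vecI) auto
  qed
  have "x0 @\<^sub>v col_stack m L z' \<in> carrier_vec (n + L * m)" using x0 by simp
  then obtain g where g: "g \<in> carrier_vec c"
    and "(X @\<^sub>r Z) *\<^sub>v g = x0 @\<^sub>v col_stack m L z'"
    using trivial_left_kernel_surjective[OF H ker] by blast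
  then have Xg: "X *\<^sub>v g = x0" and Zg: "Z *\<^sub>v g = col_stack m L z'"
    using mat_mult_append[OF X Z g] append_vec_eq[of "X *\<^sub>v g" n x0] X x0 g by auto
  have "data_comb n c g x 0 = vec_block n (X *\<^sub>v g) 0"
    unfolding X_def hankel_mult[OF g] by (subst vec_block_col_stack) auto
  also have "\<dots> = x0" unfolding Xg using x0 by (intro eq_vecI) (auto simp: vec_block_def)
  finally have "data_comb n c g x 0 = x0" .
  moreover have "data_comb m c g z i = z' i" if "i < L" for i
  proof -
    have "data_comb m c g z i = vec_block m (Z *\<^sub>v g) i"
      unfolding Z_def hankel_mult[OF g] using that by (subst vec_block_col_stack) auto
    then show ?thesis unfolding Zg using that z' by (simp add: vec_block_col_stack)
  qed
  ultimately show ?thesis using g by blast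
qed

section \<open>Superpositions of filter trajectories\<close>

locale kf_matrices =
  fixes n nu ny :: nat and A B C D K :: "real mat"
  assumes A: "A \<in> carrier_mat n n" and B: "B \<in> carrier_mat n nu"
    and C: "C \<in> carrier_mat ny n" and D: "D \<in> carrier_mat ny nu"
    and K: "K \<in> carrier_mat n ny"
begin

lemma kf_output_carrier:
  "xh \<in> carrier_vec n \<Longrightarrow> u \<in> carrier_vec nu \<Longrightarrow> kf_output C D xh u \<in> carrier_vec ny"
  unfolding kf_output_def using C D by auto

lemma kf_step_carrier:
  assumes "xh \<in> carrier_vec n" "u \<in> carrier_vec nu" "y \<in> carrier_vec ny"
  shows "kf_step A B C D K xh u y \<in> carrier_vec n"
  unfolding kf_step_def using A B K assms kf_output_carrier[OF assms(1,2)] by auto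

lemma kf_state_carrier:
  assumes "xh0 \<in> carrier_vec n" "\<And>k. u k \<in> carrier_vec nu" "\<And>k. y k \<in> carrier_vec ny"
  shows "kf_state A B C D K xh0 u y k \<in> carrier_vec n"
  using assms by (induction k) (auto intro: kf_step_carrier)

text \<open>Absorbing the innovation feedback into the state matrix exhibits the filter as the system with
  input \<open>(u, y)\<close> to which the rank assumptions refer.\<close>

lemma kf_step_predictor_form:
  assumes xh: "xh \<in> carrier_vec n" and u: "u \<in> carrier_vec nu" and y: "y \<in> carrier_vec ny"
  shows "kf_step A B C D K xh u y =
    (A - K * C) *\<^sub>v xh + append_cols (B - K * D) K *\<^sub>v (u @\<^sub>v y)"
proof -
  have KC: "K * C \<in> carrier_mat n n" and KD: "K * D \<in> carrier_mat n nu" using C D K by auto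
  have 1: "K *\<^sub>v (y - kf_output C D xh u) = K *\<^sub>v y - (K *\<^sub>v (C *\<^sub>v xh) + K *\<^sub>v (D *\<^sub>v u))"
    using C D K xh u y unfolding kf_output_def
    by (simp add: mult_minus_distrib_mat_vec[of _ n ny] mult_add_distrib_mat_vec[of _ n ny])
  have 2: "(A - K * C) *\<^sub>v xh = A *\<^sub>v xh - K *\<^sub>v (C *\<^sub>v xh)"
    using minus_mult_distrib_mat_vec[OF A KC xh] assoc_mult_mat_vec[OF K C xh] by simp
  have 3: "(B - K * D) *\<^sub>v u = B *\<^sub>v u - K *\<^sub>v (D *\<^sub>v u)"
    using minus_mult_distrib_mat_vec[OF B KD u] assoc_mult_mat_vec[OF K D u] by simp
  have 4: "append_cols (B - K * D) K *\<^sub>v (u @\<^sub>v y) = (B - K * D) *\<^sub>v u + K *\<^sub>v y"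
    by (rule append_cols_mult[OF minus_carrier_mat[OF KD] K u y])
  have rearrange: "a + b + (k - (p + q)) = (a - p) + ((b - q) + k)"
    if "a \<in> carrier_vec n" "b \<in> carrier_vec n" "k \<in> carrier_vec n"
      "p \<in> carrier_vec n" "q \<in> carrier_vec n" for a b k p q :: "real Matrix.vec"
    using that by (intro eq_vecI) auto
  note carrier = mult_mat_vec_carrier[OF A xh] mult_mat_vec_carrier[OF B u]
    mult_mat_vec_carrier[OF K y] mult_mat_vec_carrier[OF K mult_mat_vec_carrier[OF C xh]]
    mult_mat_vec_carrier[OF K mult_mat_vec_carrier[OF D u]]
  show ?thesis
    unfolding 2 3 4 unfolding kf_step_def 1 by (rule rearrange[OF carrier])
qed

context
  fixes c :: nat and g :: "real Matrix.vec" and u y xh :: "nat \<Rightarrow> real Matrix.vec"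
  assumes u: "\<And>k. u k \<in> carrier_vec nu" and y: "\<And>k. y k \<in> carrier_vec ny"
    and xh: "\<And>k. xh k \<in> carrier_vec n"
begin

lemma data_comb_kf_output:
  "data_comb ny c g (\<lambda>k. kf_output C D (xh k) (u k)) i =
    kf_output C D (data_comb n c g xh i) (data_comb nu c g u i)"
proof -
  have "data_comb ny c g (\<lambda>k. C *\<^sub>v xh k + D *\<^sub>v u k) i
      = data_comb ny c g (\<lambda>k. C *\<^sub>v xh k) i + data_comb ny c g (\<lambda>k. D *\<^sub>v u k) i"
    by (rule data_comb_add) (use C D xh u in auto)
  then show ?thesis
    unfolding kf_output_def data_comb_mult_mat_vec[OF C xh] data_comb_mult_mat_vec[OF D u] .
qed

lemma data_comb_innovation:
  "data_comb ny c g (\<lambda>k. y k - kf_output C D (xh k) (u k)) i =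
    data_comb ny c g y i - kf_output C D (data_comb n c g xh i) (data_comb nu c g u i)"
  unfolding data_comb_kf_output[symmetric]
  by (rule data_comb_diff) (use y xh u kf_output_carrier in auto)

lemma data_comb_kf_step:
  "data_comb n c g (\<lambda>k. kf_step A B C D K (xh k) (u k) (y k)) i =
    kf_step A B C D K (data_comb n c g xh i) (data_comb nu c g u i) (data_comb ny c g y i)"
proof -
  let ?e = "\<lambda>k. y k - kf_output C D (xh k) (u k)"
  have e: "?e k \<in> carrier_vec ny" for k using y xh u kf_output_carrier by auto
  have "data_comb n c g (\<lambda>k. (A *\<^sub>v xh k + B *\<^sub>v u k) + K *\<^sub>v ?e k) i
      = data_comb n c g (\<lambda>k. A *\<^sub>v xh k + B *\<^sub>v u k) i + data_comb n c g (\<lambda>k. K *\<^sub>v ?e k) i"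
    by (rule data_comb_add) (use A B K xh u e in auto)
  also have "data_comb n c g (\<lambda>k. A *\<^sub>v xh k + B *\<^sub>v u k) i
      = data_comb n c g (\<lambda>k. A *\<^sub>v xh k) i + data_comb n c g (\<lambda>k. B *\<^sub>v u k) i"
    by (rule data_comb_add) (use A B xh u in auto)
  finally show ?thesis
    unfolding kf_step_def data_comb_mult_mat_vec[OF A xh] data_comb_mult_mat_vec[OF B u]
      data_comb_mult_mat_vec[OF K e] data_comb_innovation .
qed

end

section \<open>The innovation null space constraint\<close>

text \<open>The vector \<open>g\<close> is chosen so that the superposed data start in the state \<open>xi\<close> and have the prescribed
  inputs and past outputs, followed by the predicted outputs. Since the filter is linear, the
  superposed filter states are then the states of the prediction, and the superposed future
  innovations are differences of equal vectors.\<close>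

lemma innovation_null_space:
  fixes u y :: "nat \<Rightarrow> real Matrix.vec"
  assumes u: "\<And>k. u k \<in> carrier_vec nu" and y: "\<And>k. y k \<in> carrier_vec ny"
    and xh0: "xh0 \<in> carrier_vec n"
    and willems: "willems_assumptions n (nu + ny) (A - K * C) (append_cols (B - K * D) K)
      (Lp + Lf) T (\<lambda>k. u k @\<^sub>v y k) (kf_state A B C D K xh0 u y)"
    and c: "c = T + 1 - (Lp + Lf)"
    and xi: "xi \<in> carrier_vec n" and uini: "uini \<in> carrier_vec (Lp * nu)"
    and yini: "yini \<in> carrier_vec (Lp * ny)" and uf: "uf \<in> carrier_vec (Lf * nu)"
  shows "\<exists>g \<in> carrier_vec c.
    (hankel nu 0 Lp c u @\<^sub>r hankel ny 0 Lp c y @\<^sub>r hankel nu Lp Lf c u) *\<^sub>v g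
      = uini @\<^sub>v yini @\<^sub>v uf \<and>
    kf_prediction nu ny A B C D K Lp Lf xi uini yini uf = hankel ny Lp Lf c y *\<^sub>v g \<and>
    g \<in> mat_kernel (hankel ny Lp Lf c (kf_innovation A B C D K xh0 u y))"
proof -
  define xh where "xh = kf_state A B C D K xh0 u y"
  define u' where "u' = vec_block nu (uini @\<^sub>v uf)"
  define x' where "x' = kf_pred_state A B C D K Lp xi u' (vec_block ny yini)"
  define y' where "y' k = (if k < Lp then vec_block ny yini k else kf_output C D (x' k) (u' k))" for k
  \<comment> \<open>\<open>u'\<close>, \<open>y'\<close> and \<open>x'\<close> form the trajectory to be generated: in the future window \<open>y'\<close> is the
    predicted output.\<close>
  have xh: "xh k \<in> carrier_vec n" for k
    unfolding xh_def by (rule kf_state_carrier[OF xh0 u y])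
  have xh_Suc: "xh (Suc k) = kf_step A B C D K (xh k) (u k) (y k)" for k
    unfolding xh_def by simp
  have u': "u' k \<in> carrier_vec nu" for k unfolding u'_def by simp
  have x'_Suc: "x' (Suc k) = kf_step A B C D K (x' k) (u' k) (y' k)" for k
    unfolding x'_def y'_def by (simp add: Let_def)
  have x'_y': "x' k \<in> carrier_vec n \<and> y' k \<in> carrier_vec ny" for k
  proof (induction k)
    case 0
    have "x' 0 = xi" unfolding x'_def by simp
    then show ?case using xi u' kf_output_carrier unfolding y'_def by auto
  next
    case (Suc k)
    then have "x' (Suc k) \<in> carrier_vec n" unfolding x'_Suc using u' by (intro kf_step_carrier) auto
    then show ?case using u' kf_output_carrier unfolding y'_def by auto
  qed
  have "\<exists>g \<in> carrier_vec c. data_comb n c g xh 0 = xi \<and>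
      (\<forall>i<Lp + Lf. data_comb (nu + ny) c g (\<lambda>k. u k @\<^sub>v y k) i = u' i @\<^sub>v y' i)"
  proof (rule willems_trajectory_comb[OF _ _ _ _ _ willems[folded xh_def] xi _ c])
    show "A - K * C \<in> carrier_mat n n" using A K C by auto
    show "append_cols (B - K * D) K \<in> carrier_mat n (nu + ny)"
      using B K D four_block_carrier_mat[of "B - K * D" n nu "0\<^sub>m 0 ny" 0 ny K "0\<^sub>m 0 nu"]
      unfolding append_cols_def by auto
    show "xh (Suc k) = (A - K * C) *\<^sub>v xh k + append_cols (B - K * D) K *\<^sub>v (u k @\<^sub>v y k)" for k
      unfolding xh_Suc by (rule kf_step_predictor_form[OF xh u y])
  qed (use xh u y u' x'_y' in auto)
  then obtain g where g: "g \<in> carrier_vec c" and g_x: "data_comb n c g xh 0 = xi"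
    and g_uy: "\<forall>i<Lp + Lf. data_comb (nu + ny) c g (\<lambda>k. u k @\<^sub>v y k) i = u' i @\<^sub>v y' i"
    by blast
  have g_u: "data_comb nu c g u i = u' i" and g_y: "data_comb ny c g y i = y' i"
    if "i < Lp + Lf" for i
    using g_uy[rule_format, OF that] append_vec_eq[of "data_comb nu c g u i" nu "u' i"] u'
    unfolding data_comb_append[of u nu y ny, OF u y] by auto
  have g_state: "data_comb n c g xh i = x' i" if "i \<le> Lp + Lf" for i
    using that
  proof (induction i)
    case 0
    then show ?case using g_x unfolding x'_def by simp
  next
    case (Suc i)
    have "data_comb n c g xh (Suc i) = data_comb n c g (\<lambda>k. xh (Suc k)) i"
      by (simp add: data_comb_def)
    also have "\<dots> = kf_step A B C D K (data_comb n c g xh i) (data_comb nu c g u i) (data_comb ny c g y i)"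
      unfolding xh_Suc by (rule data_comb_kf_step[OF u y xh])
    finally show ?case using Suc g_u g_y x'_Suc by simp
  qed
  have past_u: "hankel nu 0 Lp c u *\<^sub>v g = uini"
  proof -
    have "hankel nu 0 Lp c u *\<^sub>v g = col_stack nu Lp (vec_block nu uini)"
      unfolding hankel_mult[OF g]
      by (rule col_stack_cong) (simp add: g_u u'_def vec_block_append_left[OF uini])
    then show ?thesis using col_stack_vec_block[OF uini] by simp
  qed
  have past_y: "hankel ny 0 Lp c y *\<^sub>v g = yini"
  proof -
    have "hankel ny 0 Lp c y *\<^sub>v g = col_stack ny Lp (vec_block ny yini)"
      unfolding hankel_mult[OF g] by (rule col_stack_cong) (simp add: g_y y'_def)
    then show ?thesis using col_stack_vec_block[OF yini] by simp
  qed
  have future_u: "hankel nu Lp Lf c u *\<^sub>v g = uf"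
  proof -
    have "hankel nu Lp Lf c u *\<^sub>v g = col_stack nu Lf (vec_block nu uf)"
      unfolding hankel_mult[OF g]
      by (rule col_stack_cong) (simp add: g_u u'_def vec_block_append_right[OF uini uf])
    then show ?thesis using col_stack_vec_block[OF uf] by simp
  qed
  have "(hankel nu 0 Lp c u @\<^sub>r hankel ny 0 Lp c y @\<^sub>r hankel nu Lp Lf c u) *\<^sub>v g
      = hankel nu 0 Lp c u *\<^sub>v g @\<^sub>v (hankel ny 0 Lp c y @\<^sub>r hankel nu Lp Lf c u) *\<^sub>v g"
    by (rule mat_mult_append[OF hankel_carrier carrier_append_rows[OF hankel_carrier hankel_carrier] g])
  also have "(hankel ny 0 Lp c y @\<^sub>r hankel nu Lp Lf c u) *\<^sub>v g
      = hankel ny 0 Lp c y *\<^sub>v g @\<^sub>v hankel nu Lp Lf c u *\<^sub>v g"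
    by (rule mat_mult_append[OF hankel_carrier hankel_carrier g])
  finally have "(hankel nu 0 Lp c u @\<^sub>r hankel ny 0 Lp c y @\<^sub>r hankel nu Lp Lf c u) *\<^sub>v g
      = uini @\<^sub>v yini @\<^sub>v uf"
    unfolding past_u past_y future_u .
  moreover have "kf_prediction nu ny A B C D K Lp Lf xi uini yini uf = hankel ny Lp Lf c y *\<^sub>v g"
    unfolding hankel_mult[OF g] kf_prediction_def Let_def u'_def[symmetric] x'_def[symmetric]
    by (rule col_stack_cong) (simp add: g_y y'_def)
  moreover have "g \<in> mat_kernel (hankel ny Lp Lf c (kf_innovation A B C D K xh0 u y))"
  proof (rule mat_kernelI[OF hankel_carrier g])
    have innov: "kf_innovation A B C D K xh0 u y = (\<lambda>k. y k - kf_output C D (xh k) (u k))"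
      unfolding kf_innovation_def xh_def by (rule ext) simp
    have "hankel ny Lp Lf c (kf_innovation A B C D K xh0 u y) *\<^sub>v g = col_stack ny Lf (\<lambda>i. 0\<^sub>v ny)"
      unfolding hankel_mult[OF g] innov data_comb_innovation[OF u y xh]
    proof (rule col_stack_cong)
      fix i assume i: "i < Lf"
      have "y' (Lp + i) = kf_output C D (x' (Lp + i)) (u' (Lp + i))" unfolding y'_def by simp
      then show "data_comb ny c g y (Lp + i) -
          kf_output C D (data_comb n c g xh (Lp + i)) (data_comb nu c g u (Lp + i)) = 0\<^sub>v ny"
        using i x'_y'[of "Lp + i"] by (simp add: g_u g_y g_state)
    qed
    also have "\<dots> = 0\<^sub>v (Lf * ny)"
    proof (rule eq_vecI)
      fix r assume "r < dim_vec (0\<^sub>v (Lf * ny) :: real Matrix.vec)"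
      then have "r < Lf * ny" "0 < ny" by (auto intro: ccontr)
      then show "col_stack ny Lf (\<lambda>i. 0\<^sub>v ny) $ r = 0\<^sub>v (Lf * ny) $ r"
        by (simp add: col_stack_def)
    qed (simp add: col_stack_def)
    finally show "hankel ny Lp Lf c (kf_innovation A B C D K xh0 u y) *\<^sub>v g = 0\<^sub>v (Lf * ny)" .
  qed
  ultimately show ?thesis using g by blast
qed

end

lemma space_vec_borel: "space (vec_borel n) = carrier_vec n"
  unfolding vec_borel_def by simp

lemma kalman_gain_carrier:
  assumes "A \<in> carrier_mat n n" "C \<in> carrier_mat p n" "steady_state_kalman_gain n p A C Sw Sv K"
  shows "K \<in> carrier_mat n p"
proof -
  obtain P W where P: "P \<in> carrier_mat n n" and W: "W \<in> carrier_mat p p"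
    and K: "K = A * P * transpose_mat C * W"
    using assms(3) unfolding steady_state_kalman_gain_def symmetric_psd_def by blast
  show ?thesis
    unfolding K by (intro mult_carrier_mat[of _ n p] mult_carrier_mat[of _ n n])
      (use assms(1,2) P W in auto)
qed

theorem theorem2:
  fixes M :: "'w measure"
    and n nu ny N Lp Lf :: nat
    and A B C D K Sw Sv :: "real mat"
    and x u y w v :: "nat \<Rightarrow> 'w \<Rightarrow> real Matrix.vec"
    and xh0 :: "'w \<Rightarrow> real Matrix.vec"
  assumes prob: "prob_space M"
    and matrices: "A \<in> carrier_mat n n" "B \<in> carrier_mat n nu"
      "C \<in> carrier_mat ny n" "D \<in> carrier_mat ny nu"
    and horizon: "Lp \<le> N"
    and random_vectors: "x 0 \<in> measurable M (vec_borel n)" "xh0 \<in> measurable M (vec_borel n)"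
      "\<And>t. u t \<in> measurable M (vec_borel nu)"
    and process_noise: "\<And>t. centred_gaussian_vec M n Sw (w t)"
    and measurement_noise: "\<And>t. centred_gaussian_vec M ny Sv (v t)"
    and noise_indep: "prob_space.indep_vars M
      (case_sum (\<lambda>_. vec_borel n) (\<lambda>_. vec_borel ny)) (case_sum w v) (UNIV :: (nat + nat) set)"
    and state_eq: "\<And>t \<omega>. \<omega> \<in> space M \<Longrightarrow>
      x (Suc t) \<omega> = A *\<^sub>v x t \<omega> + B *\<^sub>v u t \<omega> + w t \<omega>"
    and output_eq: "\<And>t \<omega>. \<omega> \<in> space M \<Longrightarrow>
      y t \<omega> = C *\<^sub>v x t \<omega> + D *\<^sub>v u t \<omega> + v t \<omega>"
    and gain: "steady_state_kalman_gain n ny A C Sw Sv K"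
    and input_pe: "AE \<omega> in M. persistently_exciting nu (Lp + Lf) (N + Lf) (\<lambda>k. u k \<omega>)"
    and willems: "AE \<omega> in M. willems_assumptions n (nu + ny)
      (A - K * C) (append_cols (B - K * D) K) (Lp + Lf) (N + Lf)
      (\<lambda>k. u k \<omega> @\<^sub>v y k \<omega>)
      (kf_state A B C D K (xh0 \<omega>) (\<lambda>i. u i \<omega>) (\<lambda>i. y i \<omega>))"
  shows "AE \<omega> in M.
    let c = N - Lp + 1;
        u\<^sub>d = (\<lambda>k. u k \<omega>);
        y\<^sub>d = (\<lambda>k. y k \<omega>);
        U\<^sub>p = hankel nu 0 Lp c u\<^sub>d;
        U\<^sub>f = hankel nu Lp Lf c u\<^sub>d;
        Y\<^sub>p = hankel ny 0 Lp c y\<^sub>d;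
        Y\<^sub>f = hankel ny Lp Lf c y\<^sub>d;
        E\<^sub>f = hankel ny Lp Lf c (kf_innovation A B C D K (xh0 \<omega>) u\<^sub>d y\<^sub>d)
    in \<forall>xi \<in> carrier_vec n. \<forall>uini \<in> carrier_vec (Lp * nu).
       \<forall>yini \<in> carrier_vec (Lp * ny). \<forall>uf \<in> carrier_vec (Lf * nu).
         \<exists>g \<in> carrier_vec c.
           (U\<^sub>p @\<^sub>r Y\<^sub>p @\<^sub>r U\<^sub>f) *\<^sub>v g = uini @\<^sub>v yini @\<^sub>v uf \<and>
           kf_prediction nu ny A B C D K Lp Lf xi uini yini uf = Y\<^sub>f *\<^sub>v g \<and>
           g \<in> mat_kernel E\<^sub>f"
proof (rule AE_mp[OF willems AE_I2], rule impI)
  fix \<omega>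
  assume \<omega>: "\<omega> \<in> space M"
    and willems_\<omega>: "willems_assumptions n (nu + ny)
      (A - K * C) (append_cols (B - K * D) K) (Lp + Lf) (N + Lf)
      (\<lambda>k. u k \<omega> @\<^sub>v y k \<omega>)
      (kf_state A B C D K (xh0 \<omega>) (\<lambda>i. u i \<omega>) (\<lambda>i. y i \<omega>))"
  interpret kf_matrices n nu ny A B C D K
    using matrices kalman_gain_carrier[OF matrices(1,3) gain] by unfold_locales
  have u: "u k \<omega> \<in> carrier_vec nu" for k
    using measurable_space[OF random_vectors(3) \<omega>] by (simp add: space_vec_borel)
  have xh0: "xh0 \<omega> \<in> carrier_vec n"
    using measurable_space[OF random_vectors(2) \<omega>] by (simp add: space_vec_borel)
  have v: "v k \<omega> \<in> carrier_vec ny" for k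
    using measurement_noise[of k] measurable_space[OF _ \<omega>, of "v k" "vec_borel ny"]
    unfolding centred_gaussian_vec_def by (simp add: space_vec_borel)
  have y: "y k \<omega> \<in> carrier_vec ny" for k
  proof (rule carrier_vecI)
    have "dim_vec (y k \<omega>) = dim_vec (v k \<omega>)"
      by (subst output_eq[OF \<omega>]) (rule index_add_vec(2))
    then show "dim_vec (y k \<omega>) = ny" using carrier_vecD[OF v] by simp
  qed
  have c: "N - Lp + 1 = N + Lf + 1 - (Lp + Lf)" using horizon by simp
  show "let c = N - Lp + 1;
        u\<^sub>d = (\<lambda>k. u k \<omega>);
        y\<^sub>d = (\<lambda>k. y k \<omega>);
        U\<^sub>p = hankel nu 0 Lp c u\<^sub>d;
        U\<^sub>f = hankel nu Lp Lf c u\<^sub>d;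
        Y\<^sub>p = hankel ny 0 Lp c y\<^sub>d;
        Y\<^sub>f = hankel ny Lp Lf c y\<^sub>d;
        E\<^sub>f = hankel ny Lp Lf c (kf_innovation A B C D K (xh0 \<omega>) u\<^sub>d y\<^sub>d)
    in \<forall>xi \<in> carrier_vec n. \<forall>uini \<in> carrier_vec (Lp * nu).
       \<forall>yini \<in> carrier_vec (Lp * ny). \<forall>uf \<in> carrier_vec (Lf * nu).
         \<exists>g \<in> carrier_vec c.
           (U\<^sub>p @\<^sub>r Y\<^sub>p @\<^sub>r U\<^sub>f) *\<^sub>v g = uini @\<^sub>v yini @\<^sub>v uf \<and>
           kf_prediction nu ny A B C D K Lp Lf xi uini yini uf = Y\<^sub>f *\<^sub>v g \<and>
           g \<in> mat_kernel E\<^sub>f"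
    unfolding Let_def using innovation_null_space[OF u y xh0 willems_\<omega> c] by blast
qed

end
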